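(* For each $i\in I$, let $w_i>0$, $v_i>0$, and let $W_i$ and $V_i$ be closed subspaces of $\mathcal{H}$. For each $i\in I$ let $\{f_i^{\ell}\}_{\ell\in L_i}$ be a frame for $W_i$ with frame bounds $\alpha_i,\beta_i$, and let $\{\tilde f_i^{\ell}\}_{\ell\in L_i}$ be a frame for $V_i$ with frame bounds $\tilde\alpha_i,\tilde\beta_i$. Suppose that $0<\alpha=\inf_{i\in I}\alpha_i\le\beta=\sup_{i\in I}\beta_i<\infty$ and $0<\tilde\alpha=\inf_{i\in I}\tilde\alpha_i\le\tilde\beta=\sup_{i\in I}\tilde\beta_i<\infty$. Let $$Q:\mathcal{K}_{\mathcal{W}}\to\mathcal{K}_{\mathcal{V}},\qquad Q\{h_i\}_{i\in I}:=\Big\{\sum_{\ell\in L_i}\langle h_i,f_i^{\ell}\rangle\tilde f_i^{\ell}\Big\}_{i\in I}.$$ The following conditions are equivalent: (1) $\{w_if_i^{\ell}\}_{i\in I,\,\ell\in L_i}$ and $\{v_i\tilde f_i^{\ell}\}_{i\in I,\,\ell\in L_i}$ are dual frames in $\mathcal{H}$. (2) $(\mathcal{V},v)=\{(V_i,v_i)\}_{i\in I}$ is a $Q$-dual fusion frame of $(\mathcal{W},w)=\{(W_i,w_i)\}_{i\in I}$.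
   Context: $\mathcal{H}$ is a separable Hilbert space, and $I$ and the $L_i$ are countable index sets. $L(\mathcal{X},\mathcal{Y})$ denotes the bounded linear operators from $\mathcal{X}$ to $\mathcal{Y}$, and $\pi_V$ the orthogonal projection onto a closed subspace $V$. All families of weights $w=\{w_i\}_{i\in I}$, $v=\{v_i\}_{i\in I}$ are assumed to be in $\ell^\infty(I)$. Frames: a family $\{f_j\}_{j\in J}$ in a Hilbert space $\mathcal{X}$ ($J$ countable) is a frame for $\mathcal{X}$ with frame bounds $\alpha,\beta$ if $0<\alpha\le\beta<\infty$ and $\alpha\|f\|^2\le\sum_{j\in J}|\langle f,f_j\rangle|^2\le\beta\|f\|^2$ for all $f\in\mathcal{X}$. Two frames $\{f_j\}_{j\in J}$ and $\{g_j\}_{j\in J}$ for $\mathcal{X}$ are dual frames if $f=\sum_{j\in J}\langle f,f_j\rangle g_j$ for all $f\in\mathcal{X}$. Fusion frames: $(\mathcal{W},w)=\{(W_i,w_i)\}_{i\in I}$, with $W_i$ closed subspaces of $\mathcal{H}$ and $w_i>0$, is a fusion frame for $\mathcal{H}$ if there are constants $0<a\le b<\infty$ with $a\|f\|^2\le\sum_{i\in I}w_i^2\|\pi_{W_i}(f)\|^2\le b\|f\|^2$ for all $f\in\mathcal{H}$. $\mathcal{K}_{\mathcal{W}}:=\bigoplus_{i\in I}W_i=\{\{f_i\}_{i\in I}: f_i\in W_i,\ \{\|f_i\|\}_{i\in I}\in\ell^2(I)\}$ is a Hilbert space with inner product $\langle\{f_i\},\{g_i\}\rangle=\sum_{i\in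 I}\langle f_i,g_i\rangle$. For a fusion frame, the synthesis operator is the bounded operator $T_{\mathcal{W},w}:\mathcal{K}_{\mathcal{W}}\to\mathcal{H}$, $T_{\mathcal{W},w}\{f_i\}_{i\in I}=\sum_{i\in I}w_if_i$, and the analysis operator is its adjoint $T^{*}_{\mathcal{W},w}:\mathcal{H}\to\mathcal{K}_{\mathcal{W}}$, $T^{*}_{\mathcal{W},w}f=\{w_i\pi_{W_i}(f)\}_{i\in I}$; the same notation is used for $(\mathcal{V},v)$. For $Q\in L(\mathcal{K}_{\mathcal{W}},\mathcal{K}_{\mathcal{V}})$, $(\mathcal{V},v)$ is a $Q$-dual fusion frame of $(\mathcal{W},w)$ if $(\mathcal{W},w)$ and $(\mathcal{V},v)$ are fusion frames for $\mathcal{H}$ and $T_{\mathcal{V},v}QT^{*}_{\mathcal{W},w}=I_{\mathcal{H}}$. *)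

theory Defs
  imports "HOL-Analysis.Analysis"
begin

section \<open>Hilbert spaces over the real or complex numbers\<close>

text \<open>
  A field in this class is isomorphic to the real or the complex numbers: for every \<open>x\<close> the elements
  \<open>x * sconj x\<close> and \<open>x + sconj x\<close> (expand \<open>(1 + x) * sconj (1 + x)\<close>) are real, so every \<open>x\<close> is a root
  of a real quadratic polynomial. On the reals \<open>sconj\<close> is the identity.
\<close>

class real_or_complex = real_normed_field +
  fixes sconj :: "'a \<Rightarrow> 'a"
  assumes sconj_add: "sconj (x + y) = sconj x + sconj y"
    and mult_sconj: "x * sconj x = (norm x)\<^sup>2 *\<^sub>R 1"

instantiation real :: real_or_complex
begin
definition sconj_real :: "real \<Rightarrow> real" where "sconj_real x = x"
instance by standard (simp_all add: sconj_real_def power2_eq_square)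
end

instantiation complex :: real_or_complex
begin
definition sconj_complex :: "complex \<Rightarrow> complex" where "sconj_complex = cnj"
instance by standard (simp_all add: sconj_complex_def complex_norm_square scaleR_conv_of_real del: of_real_power)
end

text \<open>
  Completeness comes from the class \<open>banach\<close>, whose norm is required to be the one induced by the
  inner product \<open>ip\<close>. The inner product is linear in its first argument.
\<close>

locale hilbert_space = vector_space scl
  for scl :: "'k::real_or_complex \<Rightarrow> 'h::banach \<Rightarrow> 'h" +
  fixes ip :: "'h \<Rightarrow> 'h \<Rightarrow> 'k"
  assumes scl_of_real: "scl (of_real r) x = r *\<^sub>R x"
    and ip_add_left: "ip (x + y) z = ip x z + ip y z"
    and ip_scl_left: "ip (scl c x) y = c * ip x y"
    and ip_commute: "ip x y = sconj (ip y x)"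
    and ip_self: "ip x x = of_real ((norm x)\<^sup>2)"

lemma hilbert_space_real:
  "hilbert_space (scaleR :: real \<Rightarrow> 'h \<Rightarrow> 'h::{real_inner, banach}) inner"
  by unfold_locales
    (simp_all add: scaleR_right_distrib scaleR_left_distrib inner_add_left inner_add_right sconj_real_def
      inner_commute power2_norm_eq_inner)

lemma hilbert_space_complex: "hilbert_space ((*) :: complex \<Rightarrow> _) (\<lambda>x y. x * cnj y)"
  by unfold_locales
    (simp_all add: algebra_simps sconj_complex_def complex_norm_square scaleR_conv_of_real
      del: of_real_power)

definition closed_subspace :: "('k::real_or_complex \<Rightarrow> 'h::banach \<Rightarrow> 'h) \<Rightarrow> 'h set \<Rightarrow> bool" where
  "closed_subspace scl X \<longleftrightarrow> module.subspace scl X \<and> closed X"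

definition orth_proj :: "('h::banach \<Rightarrow> 'h \<Rightarrow> 'k::real_or_complex) \<Rightarrow> 'h set \<Rightarrow> 'h \<Rightarrow> 'h" where
  "orth_proj ip X x = (THE y. y \<in> X \<and> (\<forall>u\<in>X. ip (x - y) u = 0))"

section \<open>Frames\<close>

text \<open>Here \<open>X\<close> is meant to be a closed subspace, regarded as a Hilbert space on its own.\<close>

definition frame_with_bounds ::
  "('h::banach \<Rightarrow> 'h \<Rightarrow> 'k::real_or_complex) \<Rightarrow> 'h set \<Rightarrow> 'j set \<Rightarrow> ('j \<Rightarrow> 'h) \<Rightarrow> real \<Rightarrow> real \<Rightarrow> bool"
where
  "frame_with_bounds ip X J f \<alpha> \<beta> \<longleftrightarrow>
     countable J \<and> (\<forall>j\<in>J. f j \<in> X) \<and> 0 < \<alpha> \<and> \<alpha> \<le> \<beta> \<and>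
     (\<forall>x\<in>X. (\<lambda>j. (norm (ip x (f j)))\<^sup>2) summable_on J \<and>
        \<alpha> * (norm x)\<^sup>2 \<le> (\<Sum>\<^sub>\<infinity>j\<in>J. (norm (ip x (f j)))\<^sup>2) \<and>
        (\<Sum>\<^sub>\<infinity>j\<in>J. (norm (ip x (f j)))\<^sup>2) \<le> \<beta> * (norm x)\<^sup>2)"

definition is_frame ::
  "('h::banach \<Rightarrow> 'h \<Rightarrow> 'k::real_or_complex) \<Rightarrow> 'h set \<Rightarrow> 'j set \<Rightarrow> ('j \<Rightarrow> 'h) \<Rightarrow> bool"
where
  "is_frame ip X J f \<longleftrightarrow> (\<exists>\<alpha> \<beta>. frame_with_bounds ip X J f \<alpha> \<beta>)"

definition dual_frames ::
  "('k::real_or_complex \<Rightarrow> 'h::banach \<Rightarrow> 'h) \<Rightarrow> ('h \<Rightarrow> 'h \<Rightarrow> 'k) \<Rightarrow> 'h set \<Rightarrow> 'j set \<Rightarrow>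
     ('j \<Rightarrow> 'h) \<Rightarrow> ('j \<Rightarrow> 'h) \<Rightarrow> bool"
where
  "dual_frames scl ip X J f g \<longleftrightarrow>
     is_frame ip X J f \<and> is_frame ip X J g \<and>
     (\<forall>x\<in>X. ((\<lambda>j. scl (ip x (f j)) (g j)) has_sum x) J)"

section \<open>Fusion frames\<close>

definition fusion_frame ::
  "('k::real_or_complex \<Rightarrow> 'h::banach \<Rightarrow> 'h) \<Rightarrow> ('h \<Rightarrow> 'h \<Rightarrow> 'k) \<Rightarrow> 'i set \<Rightarrow>
     ('i \<Rightarrow> 'h set) \<Rightarrow> ('i \<Rightarrow> real) \<Rightarrow> bool"
where
  "fusion_frame scl ip I W w \<longleftrightarrow>
     countable I \<and> (\<forall>i\<in>I. closed_subspace scl (W i) \<and> 0 < w i) \<and>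
     (\<exists>a b. 0 < a \<and> a \<le> b \<and>
        (\<forall>x. (\<lambda>i. (w i)\<^sup>2 * (norm (orth_proj ip (W i) x))\<^sup>2) summable_on I \<and>
           a * (norm x)\<^sup>2 \<le> (\<Sum>\<^sub>\<infinity>i\<in>I. (w i)\<^sup>2 * (norm (orth_proj ip (W i) x))\<^sup>2) \<and>
           (\<Sum>\<^sub>\<infinity>i\<in>I. (w i)\<^sup>2 * (norm (orth_proj ip (W i) x))\<^sup>2) \<le> b * (norm x)\<^sup>2))"

text \<open>
  Families indexed by \<open>I\<close> are represented by functions that vanish outside \<open>I\<close>, so that equality of
  functions is equality of families and the families form a vector space pointwise.
\<close>

definition dsum :: "'i set \<Rightarrow> ('i \<Rightarrow> 'h::banach set) \<Rightarrow> ('i \<Rightarrow> 'h) set" where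
  "dsum I W = {h. (\<forall>i\<in>I. h i \<in> W i) \<and> (\<forall>i. i \<notin> I \<longrightarrow> h i = 0) \<and>
                  (\<lambda>i. (norm (h i))\<^sup>2) summable_on I}"

definition dsum_ip ::
  "('h::banach \<Rightarrow> 'h \<Rightarrow> 'k::real_or_complex) \<Rightarrow> 'i set \<Rightarrow> ('i \<Rightarrow> 'h) \<Rightarrow> ('i \<Rightarrow> 'h) \<Rightarrow> 'k"
where
  "dsum_ip ip I h k = (\<Sum>\<^sub>\<infinity>i\<in>I. ip (h i) (k i))"

definition dsum_norm :: "'i set \<Rightarrow> ('i \<Rightarrow> 'h::banach) \<Rightarrow> real" where
  "dsum_norm I h = sqrt (\<Sum>\<^sub>\<infinity>i\<in>I. (norm (h i))\<^sup>2)"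

definition dsum_bounded_linear ::
  "('k::real_or_complex \<Rightarrow> 'h::banach \<Rightarrow> 'h) \<Rightarrow> 'i set \<Rightarrow> ('i \<Rightarrow> 'h set) \<Rightarrow> ('i \<Rightarrow> 'h set) \<Rightarrow>
     (('i \<Rightarrow> 'h) \<Rightarrow> ('i \<Rightarrow> 'h)) \<Rightarrow> bool"
where
  "dsum_bounded_linear scl I W V Q \<longleftrightarrow>
     (\<forall>h\<in>dsum I W. Q h \<in> dsum I V) \<and>
     (\<forall>h\<in>dsum I W. \<forall>k\<in>dsum I W. Q (\<lambda>i. h i + k i) = (\<lambda>i. Q h i + Q k i)) \<and>
     (\<forall>c. \<forall>h\<in>dsum I W. Q (\<lambda>i. scl c (h i)) = (\<lambda>i. scl c (Q h i))) \<and>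
     (\<exists>C. \<forall>h\<in>dsum I W. dsum_norm I (Q h) \<le> C * dsum_norm I h)"

definition synthesis :: "'i set \<Rightarrow> ('i \<Rightarrow> real) \<Rightarrow> ('i \<Rightarrow> 'h::banach) \<Rightarrow> 'h" where
  "synthesis I w h = (\<Sum>\<^sub>\<infinity>i\<in>I. w i *\<^sub>R h i)"

text \<open>
  The analysis operator is the adjoint of the synthesis operator as an operator on \<open>dsum I W\<close>; for a
  fusion frame it sends \<open>x\<close> to the family \<open>w i *\<^sub>R orth_proj ip (W i) x\<close>.
\<close>

definition analysis ::
  "('h::banach \<Rightarrow> 'h \<Rightarrow> 'k::real_or_complex) \<Rightarrow> 'i set \<Rightarrow> ('i \<Rightarrow> 'h set) \<Rightarrow> ('i \<Rightarrow> real) \<Rightarrow>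
     'h \<Rightarrow> ('i \<Rightarrow> 'h)"
where
  "analysis ip I W w x =
     (THE k. k \<in> dsum I W \<and> (\<forall>h\<in>dsum I W. ip (synthesis I w h) x = dsum_ip ip I h k))"

text \<open>\<open>(V, v)\<close> is a \<open>Q\<close>-dual fusion frame of \<open>(W, w)\<close>:\<close>

definition Q_dual_fusion_frame ::
  "('k::real_or_complex \<Rightarrow> 'h::banach \<Rightarrow> 'h) \<Rightarrow> ('h \<Rightarrow> 'h \<Rightarrow> 'k) \<Rightarrow> 'i set \<Rightarrow>
     (('i \<Rightarrow> 'h) \<Rightarrow> ('i \<Rightarrow> 'h)) \<Rightarrow>
     ('i \<Rightarrow> 'h set) \<Rightarrow> ('i \<Rightarrow> real) \<Rightarrow> ('i \<Rightarrow> 'h set) \<Rightarrow> ('i \<Rightarrow> real) \<Rightarrow> bool"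
where
  "Q_dual_fusion_frame scl ip I Q V v W w \<longleftrightarrow>
     dsum_bounded_linear scl I W V Q \<and>
     fusion_frame scl ip I W w \<and> fusion_frame scl ip I V v \<and>
     (\<forall>x. synthesis I v (Q (analysis ip I W w x)) = x)"

end

theory Submission
  imports Defs
begin

text \<open>
  Since \<open>f i l \<in> W i\<close>, the coefficient of \<open>x\<close> at \<open>w i *\<^sub>R f i l\<close> is \<open>w i\<close> times the one of the
  projection of \<open>x\<close> onto \<open>W i\<close> at \<open>f i l\<close>. Summing over \<open>l\<close> first and using the uniform local
  frame bounds, the weighted family is a frame for the whole space iff \<open>(W, w)\<close> is a fusion frame,
  and likewise for \<open>(V, v)\<close>. In that case the double series \<open>\<Sum> \<langle>x, w i f i l\<rangle> v i g i l\<close> converges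
  unconditionally, and its iterated sum is \<open>T\<^sub>V Q T\<^sub>W\<^sup>* x\<close>, so the two reconstruction formulas
  coincide.
\<close>

section \<open>Conjugation of scalars\<close>

text \<open>In a field \<open>mult_sconj\<close> can be solved for \<open>sconj x\<close> once
  \<open>x\<close> is nonzero. Multiplicativity, the norm and the values on real scalars are all
  read off from this formula; the value at 0 comes from additivity instead.\<close>

lemma sconj_eq:
  fixes x :: "'k::real_or_complex"
  assumes "x \<noteq> 0"
  shows "sconj x = of_real ((norm x)\<^sup>2) / x"
  using mult_sconj[of x] assms by (simp add: field_simps scaleR_conv_of_real)

lemma sconj_0 [simp]: "sconj (0::'k::real_or_complex) = 0"
  using sconj_add[of "0::'k" 0] by simp

lemma norm_sconj [simp]: "norm (sconj (x::'k::real_or_complex)) = norm x"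
  by (cases "x = 0") (simp_all add: sconj_eq norm_divide norm_mult power2_eq_square)

lemma sconj_mult: "sconj (x * y) = sconj x * sconj (y::'k::real_or_complex)"
  by (cases "x = 0 \<or> y = 0") (auto simp: sconj_eq norm_mult power_mult_distrib)

lemma sconj_of_real [simp]: "sconj (of_real r :: 'k::real_or_complex) = of_real r"
  by (cases "r = 0") (simp_all add: sconj_eq power2_eq_square)

section \<open>Unconditional convergence from a square bound\<close>

text \<open>A comparison test for series that need not converge absolutely: the squared norm of a
  finite partial sum, not each single norm, is compared with a convergent nonnegative series. Small
  tails of \<open>a\<close> make the partial sums of \<open>f\<close> a Cauchy filter, and
  completeness does the rest.\<close>

lemma sum_Cauchy_bound:
  fixes f :: "'a \<Rightarrow> 'b::banach" and a :: "'a \<Rightarrow> real"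
  assumes a: "a summable_on A" "\<And>x. x \<in> A \<Longrightarrow> 0 \<le> a x" and "0 \<le> B"
    and le: "\<And>F. finite F \<Longrightarrow> F \<subseteq> A \<Longrightarrow> (norm (sum f F))\<^sup>2 \<le> B * sum a F"
  shows "f summable_on A" and "(norm (infsum f A))\<^sup>2 \<le> B * infsum a A"
proof -
  have "\<exists>P. eventually P (finite_subsets_at_top A) \<and>
      (\<forall>F F'. P F \<and> P F' \<longrightarrow> dist (sum f F) (sum f F') < e)" if "e > 0" for e
  proof -
    \<comment> \<open>Chosen so that \<open>(B + 1) * d\<close> is the square of \<open>e/2\<close>;
      the summand 1 avoids dividing by zero when \<open>B = 0\<close>.\<close>
    define d where "d = (e/2)\<^sup>2 / (B + 1)"
    have "d > 0" using that \<open>0 \<le> B\<close> by (simp add: d_def)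
    then have "d/2 > 0" by simp
    obtain F0 where F0: "finite F0" "F0 \<subseteq> A" "dist (sum a F0) (infsum a A) \<le> d/2"
      using infsum_finite_approximation[OF a(1) \<open>d/2 > 0\<close>] by blast
    \<comment> \<open>A finite set disjoint from \<open>F0\<close> carries at most what
      \<open>F0\<close> leaves of the total mass of \<open>a\<close>, which is at most
      \<open>d/2\<close>.\<close>
    have tail: "norm (sum f G) < e/2" if G: "finite G" "G \<subseteq> A" "G \<inter> F0 = {}" for G
    proof -
      have "sum a G + sum a F0 = sum a (G \<union> F0)"
        using G F0 by (simp add: sum.union_disjoint)
      also have "\<dots> \<le> infsum a A"
        using G F0 a by (intro finite_sum_le_infsum) auto
      finally have "sum a G \<le> d/2" using F0(3) unfolding dist_real_def by linarith
      then have "sum a G < d" using \<open>d > 0\<close> by simp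
      have "0 \<le> sum a G" using G a by (intro sum_nonneg) auto
      then have "(norm (sum f G))\<^sup>2 \<le> (B + 1) * sum a G"
        using le[OF G(1,2)] by (simp add: algebra_simps)
      also have "\<dots> < (B + 1) * d" using \<open>sum a G < d\<close> \<open>0 \<le> B\<close> by simp
      also have "\<dots> = (e/2)\<^sup>2" using \<open>0 \<le> B\<close> by (simp add: d_def)
      finally show ?thesis by (rule power_less_imp_less_base) (use \<open>e > 0\<close> in simp)
    qed
    \<comment> \<open>Both partial sums share the part over \<open>F0\<close>, so they differ by two
      tails.\<close>
    have "dist (sum f F) (sum f F') < e"
      if "finite F \<and> F0 \<subseteq> F \<and> F \<subseteq> A" "finite F' \<and> F0 \<subseteq> F' \<and> F' \<subseteq> A" for F F'
    proof -
      have *: "sum f G = sum f F0 + sum f (G - F0)" if "finite G \<and> F0 \<subseteq> G \<and> G \<subseteq> A" for G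
        using sum.subset_diff[of F0 G f] that by (simp add: add.commute)
      have "norm (sum f (F - F0)) < e/2" "norm (sum f (F' - F0)) < e/2"
        using that tail[of "F - F0"] tail[of "F' - F0"] by blast+
      then show ?thesis
        using norm_triangle_ineq4[of "sum f (F - F0)" "sum f (F' - F0)"]
        by (simp add: *[OF that(1)] *[OF that(2)] dist_norm)
    qed
    moreover have "eventually (\<lambda>F. finite F \<and> F0 \<subseteq> F \<and> F \<subseteq> A) (finite_subsets_at_top A)"
      using F0 by (auto simp: eventually_finite_subsets_at_top)
    ultimately show ?thesis
      by (intro exI[of _ "\<lambda>F. finite F \<and> F0 \<subseteq> F \<and> F \<subseteq> A"]) simp
  qed
  then have "cauchy_filter (filtermap (sum f) (finite_subsets_at_top A))"
    by (simp add: cauchy_filter_metric_filtermap)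
  then have "\<exists>L. (sum f \<longlongrightarrow> L) (finite_subsets_at_top A)"
    using cauchy_filter_convergent by (auto simp: convergent_filter_iff filterlim_def)
  then show f: "f summable_on A" by (simp add: summable_on_def has_sum_def)
  have "((\<lambda>F. (norm (sum f F))\<^sup>2) \<longlongrightarrow> (norm (infsum f A))\<^sup>2) (finite_subsets_at_top A)"
    using f by (intro tendsto_intros infsum_tendsto)
  moreover have "\<forall>\<^sub>F F in finite_subsets_at_top A. (norm (sum f F))\<^sup>2 \<le> B * infsum a A"
  proof (rule eventually_finite_subsets_at_top_weakI)
    fix F assume F: "finite F" "F \<subseteq> A"
    have "sum a F \<le> infsum a A" using F a by (intro finite_sum_le_infsum) auto
    from order_trans[OF le[OF F] mult_left_mono[OF this \<open>0 \<le> B\<close>]]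
    show "(norm (sum f F))\<^sup>2 \<le> B * infsum a A" .
  qed
  ultimately show "(norm (infsum f A))\<^sup>2 \<le> B * infsum a A"
    by (rule tendsto_upperbound) simp
qed

context hilbert_space
begin

section \<open>Inner product algebra and the Cauchy-Schwarz inequality\<close>

lemma ip_add_right: "ip z (x + y) = ip z x + ip z y"
  by (subst (1 2 3) ip_commute) (simp add: ip_add_left sconj_add)

lemma ip_scl_right: "ip x (scl c y) = sconj c * ip x y"
  by (subst (1 2) ip_commute) (simp add: ip_scl_left sconj_mult)

lemma ip_scaleR_left [simp]: "ip (r *\<^sub>R x) y = of_real r * ip x y"
  using ip_scl_left[of "of_real r" x y] by (simp add: scl_of_real)

lemma ip_scaleR_right [simp]: "ip x (r *\<^sub>R y) = of_real r * ip x y"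
  using ip_scl_right[of x "of_real r" y] by (simp add: scl_of_real)

lemma ip_zero_left [simp]: "ip 0 y = 0"
  using ip_scaleR_left[of 0 0 y] by simp

lemma ip_zero_right [simp]: "ip y 0 = 0"
  using ip_scaleR_right[of y 0 0] by simp

lemma ip_diff_left: "ip (x - y) z = ip x z - ip y z"
  using ip_add_left[of "x - y" y z] by simp

lemma ip_diff_right: "ip z (x - y) = ip z x - ip z y"
  using ip_add_right[of z "x - y" y] by simp

lemma ip_sum_left: "ip (sum u F) x = (\<Sum>j\<in>F. ip (u j) x)"
  by (induction F rule: infinite_finite_induct) (simp_all add: ip_add_left)

lemma norm_ip_commute: "norm (ip x y) = norm (ip y x)"
  by (metis ip_commute norm_sconj)

text \<open>Pythagoras: what remains after removing the component of \<open>z\<close> along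
  \<open>u\<close> is orthogonal to \<open>u\<close>. Nonnegativity of the left side yields
  Cauchy-Schwarz, and the same identity later shows that a nearest point has an orthogonal
  residual.\<close>

lemma norm_diff_component:
  assumes "u \<noteq> 0"
  shows "(norm (z - scl (ip z u / of_real ((norm u)\<^sup>2)) u))\<^sup>2 = (norm z)\<^sup>2 - (norm (ip z u))\<^sup>2 / (norm u)\<^sup>2"
proof -
  let ?n = "of_real ((norm u)\<^sup>2) :: 'k"
  define c where "c = ip z u / ?n"
  have n: "?n \<noteq> 0" using assms by simp
  have 1: "ip (z - scl c u) u = 0"
    using n by (simp add: ip_diff_left ip_scl_left c_def ip_self)
  have "of_real ((norm (z - scl c u))\<^sup>2) = ip (z - scl c u) (z - scl c u)"
    by (simp add: ip_self)
  also have "\<dots> = ip (z - scl c u) z"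
    by (simp add: ip_diff_right[of "z - scl c u"] ip_scl_right 1)
  also have "\<dots> = ip z z - ip z u * sconj (ip z u) / ?n"
    by (simp add: ip_diff_left ip_scl_left c_def ip_commute[of u z])
  also have "\<dots> = of_real ((norm z)\<^sup>2 - (norm (ip z u))\<^sup>2 / (norm u)\<^sup>2)"
    by (simp add: mult_sconj ip_self scaleR_conv_of_real)
  finally show ?thesis unfolding c_def using of_real_eq_iff by blast
qed

lemma norm_ip_le: "norm (ip x y) \<le> norm x * norm y"
proof (cases "y = 0")
  case False
  have "0 \<le> (norm x)\<^sup>2 - (norm (ip x y))\<^sup>2 / (norm y)\<^sup>2"
    using norm_diff_component[OF False, of x] by (metis zero_le_power2)
  then have "(norm (ip x y))\<^sup>2 \<le> (norm x * norm y)\<^sup>2"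
    using False by (simp add: field_simps power_mult_distrib)
  then show ?thesis by (rule power2_le_imp_le) simp
qed simp

lemma bounded_linear_ip_left: "bounded_linear (\<lambda>x. ip x y)"
  by (rule bounded_linear_intro[of _ "norm y"])
    (simp_all add: ip_add_left scaleR_conv_of_real norm_ip_le)

lemma norm_scl: "norm (scl c x) = norm c * norm x"
proof -
  have "of_real ((norm (scl c x))\<^sup>2) = c * sconj c * ip x x"
    by (simp only: ip_self[symmetric] ip_scl_left ip_scl_right ac_simps)
  also have "\<dots> = (of_real ((norm c * norm x)\<^sup>2) :: 'k)"
    by (simp add: mult_sconj ip_self scaleR_conv_of_real power_mult_distrib)
  finally have "(norm (scl c x))\<^sup>2 = (norm c * norm x)\<^sup>2" using of_real_eq_iff by blast
  then show ?thesis by simp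
qed

lemma scl_scaleR: "scl c (r *\<^sub>R x) = r *\<^sub>R scl c x"
  by (simp flip: scl_of_real add: mult.commute)

lemma bounded_linear_scl: "bounded_linear (scl c)"
  by (rule bounded_linear_intro[of _ "norm c"])
    (simp_all add: scale_right_distrib scl_scaleR norm_scl mult.commute)

section \<open>Nearest points and orthogonal projections\<close>

lemma parallelogram:
  fixes x y :: 'h
  shows "(norm (x + y))\<^sup>2 + (norm (x - y))\<^sup>2 = 2 * (norm x)\<^sup>2 + 2 * (norm y)\<^sup>2"
proof -
  have "of_real ((norm (x + y))\<^sup>2 + (norm (x - y))\<^sup>2) = 2 * ip x x + 2 * ip y y"
    by (simp only: ip_self[symmetric] of_real_add ip_add_left ip_add_right ip_diff_left ip_diff_right)
      (simp add: algebra_simps)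
  also have "\<dots> = (of_real (2 * (norm x)\<^sup>2 + 2 * (norm y)\<^sup>2) :: 'k)"
    by (simp add: ip_self)
  finally show ?thesis using of_real_eq_iff by blast
qed

lemma subspace_scaleR: "subspace X \<Longrightarrow> x \<in> X \<Longrightarrow> r *\<^sub>R x \<in> X"
  using subspace_scale[of X x "of_real r"] by (simp add: scl_of_real)

text \<open>The parallelogram law makes a minimizing sequence Cauchy; its limit exists by
  completeness and stays in \<open>X\<close> because \<open>X\<close> is closed.\<close>

lemma nearest_point_exists:
  assumes X: "subspace X" "closed X"
  obtains y where "y \<in> X" "\<And>u. u \<in> X \<Longrightarrow> norm (x - y) \<le> norm (x - u)"
proof -
  define d where "d = (INF u\<in>X. (norm (x - u))\<^sup>2)"
  have ne: "X \<noteq> {}" using subspace_0[OF X(1)] by blast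
  have bdd: "bdd_below ((\<lambda>u. (norm (x - u))\<^sup>2) ` X)" by (intro bdd_belowI2[of _ 0]) simp
  have d_le: "d \<le> (norm (x - u))\<^sup>2" if "u \<in> X" for u
    unfolding d_def using bdd that by (rule cINF_lower)
  have "\<exists>u\<in>X. (norm (x - u))\<^sup>2 < d + 1 / real (Suc n)" for n
    using cINF_less_iff[OF ne bdd, of "d + 1 / real (Suc n)"] by (simp add: d_def)
  then obtain u where u: "\<And>n. u n \<in> X" "\<And>n. (norm (x - u n))\<^sup>2 < d + 1 / real (Suc n)"
    by metis
  have dist_le: "(norm (u m - u n))\<^sup>2 \<le> 2 / real (Suc m) + 2 / real (Suc n)" for m n
  proof -
    \<comment> \<open>The midpoint lies in \<open>X\<close>, so its squared distance to
      \<open>x\<close> is at least \<open>d\<close>. This keeps one diagonal of the parallelogram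
      long and forces the other, \<open>u m - u n\<close>, to be short.\<close>
    have "(1/2) *\<^sub>R (u m + u n) \<in> X" using u X(1) by (intro subspace_scaleR subspace_add)
    then have "d \<le> (norm (x - (1/2) *\<^sub>R (u m + u n)))\<^sup>2" by (rule d_le)
    also have "x - (1/2) *\<^sub>R (u m + u n) = (1/2) *\<^sub>R ((x - u n) + (x - u m))"
      by (simp add: algebra_simps flip: scaleR_add_left)
    finally have "4 * d \<le> (norm ((x - u n) + (x - u m)))\<^sup>2"
      by (simp add: power_mult_distrib power_divide)
    moreover have "(x - u n) - (x - u m) = u m - u n" by simp
    ultimately show ?thesis
      using parallelogram[of "x - u n" "x - u m"] u(2)[of m] u(2)[of n] by simp
  qed
  have "Cauchy u"
  proof (rule CauchyI)
    fix e :: real assume "0 < e"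
    then obtain M where M: "4 / e\<^sup>2 < real M" using reals_Archimedean2 by blast
    have "norm (u m - u n) < e" if "m \<ge> M" "n \<ge> M" for m n
    proof -
      have *: "2 / real (Suc k) < e\<^sup>2 / 2" if "k \<ge> M" for k
      proof -
        have "4 / e\<^sup>2 < real (Suc k)" using M that by linarith
        then show ?thesis using \<open>0 < e\<close> by (simp add: field_simps)
      qed
      have "(norm (u m - u n))\<^sup>2 < e\<^sup>2"
        using dist_le[of m n] *[OF that(1)] *[OF that(2)] by linarith
      then show ?thesis using \<open>0 < e\<close> by (simp add: power_less_imp_less_base)
    qed
    then show "\<exists>M. \<forall>m\<ge>M. \<forall>n\<ge>M. norm (u m - u n) < e" by blast
  qed
  then obtain y where y: "u \<longlonglongrightarrow> y" using Cauchy_convergent convergentD by blast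
  have "y \<in> X" using closed_sequentially[OF X(2) _ y] u(1) by blast
  moreover have "norm (x - y) \<le> norm (x - v)" if "v \<in> X" for v
  proof -
    have "(\<lambda>n. (norm (x - u n))\<^sup>2) \<longlonglongrightarrow> (norm (x - y))\<^sup>2"
      by (intro tendsto_intros y)
    moreover have "(\<lambda>n. d + 1 / real (Suc n)) \<longlonglongrightarrow> d + 0"
      by (intro tendsto_intros LIMSEQ_Suc lim_1_over_n)
    ultimately have "(norm (x - y))\<^sup>2 \<le> d + 0"
      by (rule LIMSEQ_le) (intro exI allI impI less_imp_le u(2))
    also have "d + 0 \<le> (norm (x - v))\<^sup>2" using d_le[OF that] by simp
    finally show ?thesis by (rule power2_le_imp_le) simp
  qed
  ultimately show thesis by (rule that)
qed

text \<open>Test with \<open>u = y - z\<close>, which lies in \<open>X\<close>. This supplies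
  uniqueness for the definite descriptions behind both \<open>orth_proj\<close> and
  \<open>analysis\<close>.\<close>

lemma orthogonal_unique:
  assumes "subspace X" "y \<in> X" "z \<in> X" "\<And>u. u \<in> X \<Longrightarrow> ip u y = ip u z"
  shows "y = z"
proof -
  have "ip (y - z) (y - z) = 0"
    using assms(4)[OF subspace_diff[OF assms(1-3)]] by (simp add: ip_diff_right)
  then show ?thesis by (simp add: ip_self)
qed

text \<open>The nearest point satisfies the description in \<open>orth_proj\<close>, and
  \<open>orthogonal_unique\<close> shows that nothing else does, so \<open>THE\<close> denotes
  it.\<close>

lemma orth_proj:
  assumes "closed_subspace scl X"
  shows orth_proj_mem: "orth_proj ip X x \<in> X"
    and orth_proj_orth: "u \<in> X \<Longrightarrow> ip (x - orth_proj ip X x) u = 0"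
proof -
  have X: "subspace X" "closed X" using assms by (auto simp: closed_subspace_def)
  obtain y where y: "y \<in> X" "\<And>u. u \<in> X \<Longrightarrow> norm (x - y) \<le> norm (x - u)"
    using nearest_point_exists[OF X] by blast
  have orth: "ip (x - y) u = 0" if "u \<in> X" for u
  proof (cases "u = 0")
    case False
    define c where "c = ip (x - y) u / of_real ((norm u)\<^sup>2)"
    \<comment> \<open>Moving \<open>y\<close> by this multiple of \<open>u\<close> would lower the
      squared distance by the square of \<open>norm (ip (x - y) u) / norm u\<close>; minimality
      forces this to vanish.\<close>
    have "y + scl c u \<in> X" using y that X(1) by (intro subspace_add subspace_scale)
    from y(2)[OF this] have "(norm (x - y))\<^sup>2 \<le> (norm (x - y - scl c u))\<^sup>2"
      by (simp add: diff_diff_eq)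
    then have "(norm (ip (x - y) u))\<^sup>2 / (norm u)\<^sup>2 \<le> 0"
      using norm_diff_component[OF False, of "x - y"] unfolding c_def by linarith
    then show ?thesis using False by (simp add: divide_le_0_iff)
  qed simp
  have "\<exists>!y. y \<in> X \<and> (\<forall>u\<in>X. ip (x - y) u = 0)"
  proof (rule ex1I[of _ y])
    show "y \<in> X \<and> (\<forall>u\<in>X. ip (x - y) u = 0)" using y orth by blast
    fix z assume z: "z \<in> X \<and> (\<forall>u\<in>X. ip (x - z) u = 0)"
    show "z = y"
    proof (rule orthogonal_unique[OF X(1)])
      fix u assume "u \<in> X"
      then have "ip z u = ip y u" using z orth by (simp add: ip_diff_left)
      then show "ip u z = ip u y" by (metis ip_commute)
    qed (use z y in auto)
  qed
  from theI'[OF this] show "orth_proj ip X x \<in> X" "u \<in> X \<Longrightarrow> ip (x - orth_proj ip X x) u = 0"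
    by (auto simp: orth_proj_def)
qed

lemma ip_orth_proj:
  assumes "closed_subspace scl X" "u \<in> X"
  shows "ip (orth_proj ip X x) u = ip x u" "ip u (orth_proj ip X x) = ip u x"
proof -
  show "ip (orth_proj ip X x) u = ip x u"
    using orth_proj_orth[OF assms, of x] by (simp add: ip_diff_left)
  then show "ip u (orth_proj ip X x) = ip u x" by (metis ip_commute)
qed

section \<open>Bessel bounds and boundedness of \<open>Q\<close>\<close>

text \<open>\<open>b x\<close> dominates the coefficients of \<open>x\<close>; both the synthesis operator of a frame and that of a
  fusion frame are instances.\<close>

lemma bessel_summable:
  assumes X: "subspace X" "\<And>j. j \<in> J \<Longrightarrow> u j \<in> X"
    and le: "\<And>x j. x \<in> X \<Longrightarrow> j \<in> J \<Longrightarrow> norm (ip (u j) x) \<le> a j * b x j"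
    and b: "\<And>x. x \<in> X \<Longrightarrow> (\<lambda>j. (b x j)\<^sup>2) summable_on J"
      "\<And>x. x \<in> X \<Longrightarrow> (\<Sum>\<^sub>\<infinity>j\<in>J. (b x j)\<^sup>2) \<le> B * (norm x)\<^sup>2"
    and a: "(\<lambda>j. (a j)\<^sup>2) summable_on J" and "0 \<le> B"
  shows "u summable_on J" "(norm (infsum u J))\<^sup>2 \<le> B * (\<Sum>\<^sub>\<infinity>j\<in>J. (a j)\<^sup>2)"
proof -
  have "(norm (sum u F))\<^sup>2 \<le> B * (\<Sum>j\<in>F. (a j)\<^sup>2)" if F: "finite F" "F \<subseteq> J" for F
  proof -
    \<comment> \<open>Duality: the partial sum is itself used as the test vector. Cauchy-Schwarz
      then bounds the square of \<open>s\<close> by a constant times \<open>s\<close>, and one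
      factor \<open>s\<close> cancels.\<close>
    define x s where "x = sum u F" and "s = (norm x)\<^sup>2"
    have x: "x \<in> X" unfolding x_def using X F by (intro subspace_sum) auto
    have "s = norm (ip x x)" by (simp add: ip_self s_def del: of_real_power)
    also have "ip x x = (\<Sum>j\<in>F. ip (u j) x)" by (subst x_def) (simp add: ip_sum_left)
    also have "norm \<dots> \<le> (\<Sum>j\<in>F. a j * b x j)"
      using F le x by (intro sum_norm_le) auto
    finally have "s\<^sup>2 \<le> (\<Sum>j\<in>F. a j * b x j)\<^sup>2" by (rule power_mono) (simp add: s_def)
    also have "\<dots> \<le> (\<Sum>j\<in>F. (a j)\<^sup>2) * (\<Sum>j\<in>F. (b x j)\<^sup>2)" by (rule Cauchy_Schwarz_ineq_sum)
    also have "\<dots> \<le> (\<Sum>j\<in>F. (a j)\<^sup>2) * (B * s)"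
    proof (rule mult_left_mono)
      have "(\<Sum>j\<in>F. (b x j)\<^sup>2) \<le> (\<Sum>\<^sub>\<infinity>j\<in>J. (b x j)\<^sup>2)"
        using b(1)[OF x] F by (intro finite_sum_le_infsum) auto
      then show "(\<Sum>j\<in>F. (b x j)\<^sup>2) \<le> B * s" using b(2)[OF x] by (simp add: s_def)
    qed (simp add: sum_nonneg)
    finally have "s * s \<le> (B * (\<Sum>j\<in>F. (a j)\<^sup>2)) * s" by (simp add: power2_eq_square mult_ac)
    moreover have "0 \<le> s" "0 \<le> B * (\<Sum>j\<in>F. (a j)\<^sup>2)"
      using \<open>0 \<le> B\<close> by (simp_all add: s_def sum_nonneg)
    ultimately have "s \<le> B * (\<Sum>j\<in>F. (a j)\<^sup>2)" by (cases "s = 0") auto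
    then show ?thesis by (simp add: s_def x_def)
  qed
  from sum_Cauchy_bound[OF a _ \<open>0 \<le> B\<close> this] show "u summable_on J"
    "(norm (infsum u J))\<^sup>2 \<le> B * (\<Sum>\<^sub>\<infinity>j\<in>J. (a j)\<^sup>2)" by auto
qed

text \<open>An instance of \<open>bessel_summable\<close>: \<open>a\<close> holds the coefficients
  of \<open>x\<close> against \<open>f\<close>, contributing \<beta>, and \<open>b\<close> those
  against \<open>g\<close>, contributing \<open>\<beta>'\<close>. It serves twice, for each
  component of \<open>Q\<close> and for the weighted families on the whole space.\<close>

lemma frame_operator_bound:
  assumes f: "frame_with_bounds ip X J f \<alpha> \<beta>" and g: "frame_with_bounds ip Y J g \<alpha>' \<beta>'"
    and "subspace Y" "x \<in> X"
  shows "(\<lambda>j. scl (ip x (f j)) (g j)) summable_on J"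
    and "(norm (\<Sum>\<^sub>\<infinity>j\<in>J. scl (ip x (f j)) (g j)))\<^sup>2 \<le> \<beta>' * \<beta> * (norm x)\<^sup>2"
proof -
  let ?u = "\<lambda>j. scl (ip x (f j)) (g j)"
  have gY: "\<And>j. j \<in> J \<Longrightarrow> ?u j \<in> Y"
    using g \<open>subspace Y\<close> by (auto simp: frame_with_bounds_def intro: subspace_scale)
  have b: "(\<lambda>j. (norm (ip y (g j)))\<^sup>2) summable_on J"
    "(\<Sum>\<^sub>\<infinity>j\<in>J. (norm (ip y (g j)))\<^sup>2) \<le> \<beta>' * (norm y)\<^sup>2" if "y \<in> Y" for y
    using g that by (auto simp: frame_with_bounds_def)
  have a: "(\<lambda>j. (norm (ip x (f j)))\<^sup>2) summable_on J"
    "(\<Sum>\<^sub>\<infinity>j\<in>J. (norm (ip x (f j)))\<^sup>2) \<le> \<beta> * (norm x)\<^sup>2"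
    using f \<open>x \<in> X\<close> by (auto simp: frame_with_bounds_def)
  have "0 \<le> \<beta>'" using g by (auto simp: frame_with_bounds_def)
  note * = bessel_summable[where a = "\<lambda>j. norm (ip x (f j))" and b = "\<lambda>y j. norm (ip y (g j))"
      and B = \<beta>' and u = ?u, OF \<open>subspace Y\<close> gY _ b a(1) \<open>0 \<le> \<beta>'\<close>]
  have le: "norm (ip (?u j) y) \<le> norm (ip x (f j)) * norm (ip y (g j))" for y j
    by (simp add: ip_scl_left norm_mult norm_ip_commute[of y])
  show "?u summable_on J" by (rule *(1)) (use le in auto)
  have "(norm (infsum ?u J))\<^sup>2 \<le> \<beta>' * (\<Sum>\<^sub>\<infinity>j\<in>J. (norm (ip x (f j)))\<^sup>2)" by (rule *(2)) (use le in auto)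
  also have "\<dots> \<le> \<beta>' * (\<beta> * (norm x)\<^sup>2)" using a(2) \<open>0 \<le> \<beta>'\<close> by (rule mult_left_mono)
  finally show "(norm (infsum ?u J))\<^sup>2 \<le> \<beta>' * \<beta> * (norm x)\<^sup>2" by (simp add: mult.assoc)
qed

lemma infsum_mem_closed_subspace:
  assumes Y: "closed_subspace scl Y" and u: "u summable_on J" "\<And>j. j \<in> J \<Longrightarrow> u j \<in> Y"
  shows "infsum u J \<in> Y"
proof (rule Lim_in_closed_set[OF _ _ _ infsum_tendsto[OF u(1)]])
  show "closed Y" using Y by (simp add: closed_subspace_def)
  show "\<forall>\<^sub>F F in finite_subsets_at_top J. sum u F \<in> Y"
    using Y u(2) by (intro eventually_finite_subsets_at_top_weakI subspace_sum)
      (auto simp: closed_subspace_def)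
qed simp

text \<open>The operator acts index by index, with squared norm at most \<open>B' * B\<close> at
  every index. This uniformity keeps the image square summable and gives the constant
  \<open>sqrt (B' * B)\<close>.\<close>

lemma dsum_bounded_linear_frame_operator:
  assumes f: "\<And>i. i \<in> I \<Longrightarrow> frame_with_bounds ip (W i) (L i) (f i) (\<alpha> i) (\<beta> i)"
    and g: "\<And>i. i \<in> I \<Longrightarrow> frame_with_bounds ip (V i) (L i) (g i) (\<alpha>' i) (\<beta>' i)"
    and V: "\<And>i. i \<in> I \<Longrightarrow> closed_subspace scl (V i)"
    and B: "\<And>i. i \<in> I \<Longrightarrow> \<beta> i \<le> B" "\<And>i. i \<in> I \<Longrightarrow> \<beta>' i \<le> B'"
    and B_nonneg: "0 \<le> B" "0 \<le> B'"
  shows "dsum_bounded_linear scl I W V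
    (\<lambda>h i. if i \<in> I then \<Sum>\<^sub>\<infinity>l\<in>L i. scl (ip (h i) (f i l)) (g i l) else 0)"
    (is "dsum_bounded_linear scl I W V ?Q")
proof -
  have sV: "subspace (V i)" if "i \<in> I" for i using V[OF that] by (simp add: closed_subspace_def)
  have summ: "(\<lambda>l. scl (ip (h i) (f i l)) (g i l)) summable_on L i"
    and bound: "(norm (?Q h i))\<^sup>2 \<le> B' * B * (norm (h i))\<^sup>2"
    if h: "h \<in> dsum I W" and i: "i \<in> I" for h i
  proof -
    have hi: "h i \<in> W i" using h i by (simp add: dsum_def)
    show "(\<lambda>l. scl (ip (h i) (f i l)) (g i l)) summable_on L i"
      using frame_operator_bound(1)[OF f[OF i] g[OF i] sV[OF i] hi] .
    have "(norm (?Q h i))\<^sup>2 \<le> \<beta>' i * \<beta> i * (norm (h i))\<^sup>2"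
      using frame_operator_bound(2)[OF f[OF i] g[OF i] sV[OF i] hi] i by simp
    also have "\<dots> \<le> B' * B * (norm (h i))\<^sup>2"
      using B[OF i] B_nonneg f[OF i] by (intro mult_right_mono mult_mono) (auto simp: frame_with_bounds_def)
    finally show "(norm (?Q h i))\<^sup>2 \<le> B' * B * (norm (h i))\<^sup>2" .
  qed
  have hsum: "(\<lambda>i. (norm (h i))\<^sup>2) summable_on I" if "h \<in> dsum I W" for h
    using that by (simp add: dsum_def)
  have Qsum: "(\<lambda>i. (norm (?Q h i))\<^sup>2) summable_on I" if h: "h \<in> dsum I W" for h
    by (rule summable_on_comparison_test[OF summable_on_cmult_right[OF hsum[OF h], of "B' * B"]])
      (use bound[OF h] in auto)
  show ?thesis
    unfolding dsum_bounded_linear_def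
  proof (intro conjI ballI allI exI)
    fix h assume h: "h \<in> dsum I W"
    have "?Q h i \<in> V i" if i: "i \<in> I" for i
    proof -
      have "scl (ip (h i) (f i l)) (g i l) \<in> V i" if "l \<in> L i" for l
        using g[OF i] that sV[OF i] by (auto simp: frame_with_bounds_def intro: subspace_scale)
      then show ?thesis
        using infsum_mem_closed_subspace[OF V[OF i] summ[OF h i]] i by simp
    qed
    then show "?Q h \<in> dsum I V" using Qsum[OF h] by (simp add: dsum_def)
    have "(\<Sum>\<^sub>\<infinity>i\<in>I. (norm (?Q h i))\<^sup>2) \<le> (\<Sum>\<^sub>\<infinity>i\<in>I. B' * B * (norm (h i))\<^sup>2)"
      using bound[OF h] by (intro infsum_mono Qsum[OF h] summable_on_cmult_right hsum[OF h])
    also have "\<dots> = B' * B * (\<Sum>\<^sub>\<infinity>i\<in>I. (norm (h i))\<^sup>2)"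
      by (rule infsum_cmult_right) (use hsum[OF h] in simp)
    finally show "dsum_norm I (?Q h) \<le> sqrt (B' * B) * dsum_norm I h"
      unfolding dsum_norm_def by (simp flip: real_sqrt_mult)
  next
    fix h k assume h: "h \<in> dsum I W" and k: "k \<in> dsum I W"
    show "?Q (\<lambda>i. h i + k i) = (\<lambda>i. ?Q h i + ?Q k i)"
    proof
      fix i show "?Q (\<lambda>i. h i + k i) i = ?Q h i + ?Q k i"
        using infsum_add[OF summ[OF h, of i] summ[OF k, of i]]
        by (simp add: ip_add_left scale_left_distrib)
    qed
  next
    fix c h assume h: "h \<in> dsum I W"
    show "?Q (\<lambda>i. scl c (h i)) = (\<lambda>i. scl c (?Q h i))"
    proof
      fix i show "?Q (\<lambda>i. scl c (h i)) i = scl c (?Q h i)"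
        using has_sum_bounded_linear[OF bounded_linear_scl[of c] has_sum_infsum[OF summ[OF h, of i]]]
        by (auto simp: ip_scl_left intro!: infsumI)
    qed
  qed
qed

section \<open>Synthesis and analysis operators of a fusion frame\<close>

text \<open>Pairing \<open>h i\<close> with \<open>x\<close> sees only the projection of
  \<open>x\<close> onto \<open>W i\<close>. Hence \<open>bessel_summable\<close> applies with
  \<open>b x i\<close> the weighted norm of that projection, and its hypothesis on \<open>b\<close>
  is the upper fusion frame bound.\<close>

lemma fusion_frame_synthesis_summable:
  assumes F: "fusion_frame scl ip I W w" and h: "h \<in> dsum I W"
  shows "(\<lambda>i. w i *\<^sub>R h i) summable_on I"
proof -
  obtain b where b: "0 < b"
    "\<And>x. (\<lambda>i. (w i)\<^sup>2 * (norm (orth_proj ip (W i) x))\<^sup>2) summable_on I"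
    "\<And>x. (\<Sum>\<^sub>\<infinity>i\<in>I. (w i)\<^sup>2 * (norm (orth_proj ip (W i) x))\<^sup>2) \<le> b * (norm x)\<^sup>2"
    using F unfolding fusion_frame_def by (meson less_le_trans)
  show ?thesis
  proof (rule bessel_summable(1)[where X = UNIV and a = "\<lambda>i. norm (h i)" and B = b
        and b = "\<lambda>x i. w i * norm (orth_proj ip (W i) x)"])
    fix x i assume i: "i \<in> I"
    have W: "closed_subspace scl (W i)" "0 < w i" "h i \<in> W i"
      using F h i by (auto simp: fusion_frame_def dsum_def)
    have "norm (ip (w i *\<^sub>R h i) x) = w i * norm (ip (h i) (orth_proj ip (W i) x))"
      using W by (simp add: ip_orth_proj norm_mult)
    also have "\<dots> \<le> w i * (norm (h i) * norm (orth_proj ip (W i) x))"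
      using W by (intro mult_left_mono norm_ip_le) simp
    finally show "norm (ip (w i *\<^sub>R h i) x) \<le> norm (h i) * (w i * norm (orth_proj ip (W i) x))"
      by (simp add: mult_ac)
  qed (use b h in \<open>auto simp: power_mult_distrib dsum_def subspace_UNIV\<close>)
qed

text \<open>The explicit family satisfies the adjoint identity, since \<open>ip\<close> passes
  through the convergent synthesis series, and testing on families supported at one index shows that
  it is the only one. The value 0 outside \<open>I\<close> is forced by the encoding of
  \<open>dsum\<close>.\<close>

lemma analysis_eq:
  assumes F: "fusion_frame scl ip I W w"
  shows "analysis ip I W w x = (\<lambda>i. if i \<in> I then w i *\<^sub>R orth_proj ip (W i) x else 0)"
    (is "_ = ?k")
  unfolding analysis_def
proof (rule the_equality)
  have W: "closed_subspace scl (W i)" "subspace (W i)" if "i \<in> I" for i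
    using F that by (auto simp: fusion_frame_def closed_subspace_def)
  have "(\<lambda>i. (w i)\<^sup>2 * (norm (orth_proj ip (W i) x))\<^sup>2) summable_on I"
    using F unfolding fusion_frame_def by blast
  then have k: "?k \<in> dsum I W"
    using W by (auto simp: dsum_def power_mult_distrib orth_proj_mem subspace_scaleR cong: summable_on_cong)
  have ip_k: "ip (synthesis I w h) x = dsum_ip ip I h ?k" if h: "h \<in> dsum I W" for h
  proof -
    have "((\<lambda>i. ip (w i *\<^sub>R h i) x) has_sum ip (synthesis I w h) x) I"
      unfolding synthesis_def
      by (intro has_sum_bounded_linear[OF bounded_linear_ip_left] has_sum_infsum
          fusion_frame_synthesis_summable[OF F h])
    then have "ip (synthesis I w h) x = (\<Sum>\<^sub>\<infinity>i\<in>I. ip (w i *\<^sub>R h i) x)" by (simp add: infsumI)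
    also have "\<dots> = dsum_ip ip I h ?k"
      unfolding dsum_ip_def using h W by (intro infsum_cong) (simp add: ip_orth_proj dsum_def)
    finally show ?thesis .
  qed
  then show "?k \<in> dsum I W \<and> (\<forall>h\<in>dsum I W. ip (synthesis I w h) x = dsum_ip ip I h ?k)"
    using k by blast
  fix k' assume k': "k' \<in> dsum I W \<and> (\<forall>h\<in>dsum I W. ip (synthesis I w h) x = dsum_ip ip I h k')"
  show "k' = ?k"
  proof
    fix i
    show "k' i = ?k i"
    proof (cases "i \<in> I")
      case True
      show ?thesis
      proof (rule orthogonal_unique[OF W(2)[OF True]])
        show "k' i \<in> W i" "?k i \<in> W i" using k k' True by (auto simp: dsum_def)
        fix u assume u: "u \<in> W i"
        \<comment> \<open>Supported at \<open>i\<close> alone, so the inner product of families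
          collapses to the one in the \<open>i\<close>-th component.\<close>
        define h where "h = (\<lambda>j. if j = i then u else 0)"
        have "(\<lambda>j. (norm (h j))\<^sup>2) summable_on I"
          by (rule finite_nonzero_values_imp_summable_on) (simp add: h_def)
        then have h: "h \<in> dsum I W" using u True W by (auto simp: dsum_def h_def subspace_0)
        have single: "dsum_ip ip I h k = ip u (k i)" for k
        proof -
          have "dsum_ip ip I h k = (\<Sum>\<^sub>\<infinity>j\<in>{i}. ip (h j) (k j))"
            unfolding dsum_ip_def using True by (intro infsum_cong_neutral) (auto simp: h_def)
          then show ?thesis by (simp add: h_def)
        qed
        have "ip u (k' i) = dsum_ip ip I h k'" by (rule single[symmetric])
        also have "\<dots> = dsum_ip ip I h ?k" using k' h ip_k[OF h] by simp
        also have "\<dots> = ip u (?k i)" by (rule single)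
        finally show "ip u (k' i) = ip u (?k i)" .
      qed
    qed (use k' in \<open>simp add: dsum_def\<close>)
  qed
qed

section \<open>Weighted local frames versus fusion frames\<close>

text \<open>The local frame inequalities put each inner sum between \<open>A\<close> and
  \<open>B\<close> times the corresponding fusion frame term. All terms are nonnegative, so the
  double sum may be regrouped, and the two sets of global bounds differ only by these
  factors.\<close>

lemma frame_iff_fusion_frame:
  assumes I: "countable I"
    and W: "\<And>i. i \<in> I \<Longrightarrow> closed_subspace scl (W i)" and w: "\<And>i. i \<in> I \<Longrightarrow> 0 < w i"
    and f: "\<And>i. i \<in> I \<Longrightarrow> frame_with_bounds ip (W i) (L i) (f i) (\<alpha> i) (\<beta> i)"
    and A: "0 < A" "\<And>i. i \<in> I \<Longrightarrow> A \<le> \<alpha> i" and B: "0 < B" "\<And>i. i \<in> I \<Longrightarrow> \<beta> i \<le> B"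
  shows "is_frame ip UNIV (Sigma I L) (\<lambda>(i, l). w i *\<^sub>R f i l) \<longleftrightarrow> fusion_frame scl ip I W w"
proof -
  \<comment> \<open>\<open>\<phi> x\<close> lists the squared frame coefficients,
    \<open>c x i\<close> is their sum over the local index, and \<open>p x i\<close> is the fusion
    frame term at \<open>i\<close>.\<close>
  define \<phi> where "\<phi> x = (\<lambda>(i, l). (norm (ip x (w i *\<^sub>R f i l)))\<^sup>2)" for x
  define c where "c x i = (\<Sum>\<^sub>\<infinity>l\<in>L i. \<phi> x (i, l))" for x i
  define p where "p x i = (w i)\<^sup>2 * (norm (orth_proj ip (W i) x))\<^sup>2" for x i
  have inner: "((\<lambda>l. \<phi> x (i, l)) has_sum c x i) (L i)" "A * p x i \<le> c x i" "c x i \<le> B * p x i"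
    if i: "i \<in> I" for x i
  proof -
    let ?P = "orth_proj ip (W i) x"
    let ?s = "\<Sum>\<^sub>\<infinity>l\<in>L i. (norm (ip ?P (f i l)))\<^sup>2"
    have P: "?P \<in> W i" by (rule orth_proj_mem[OF W[OF i]])
    have \<phi>: "\<phi> x (i, l) = (w i)\<^sup>2 * (norm (ip ?P (f i l)))\<^sup>2" if "l \<in> L i" for l
      using f[OF i] that W[OF i]
      by (simp add: \<phi>_def norm_mult power_mult_distrib ip_orth_proj frame_with_bounds_def)
    have s: "(\<lambda>l. (norm (ip ?P (f i l)))\<^sup>2) summable_on L i"
      "\<alpha> i * (norm ?P)\<^sup>2 \<le> ?s" "?s \<le> \<beta> i * (norm ?P)\<^sup>2"
      using f[OF i] P by (auto simp: frame_with_bounds_def)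
    have "((\<lambda>l. \<phi> x (i, l)) has_sum (w i)\<^sup>2 * ?s) (L i)"
      using has_sum_cmult_right[OF has_sum_infsum[OF s(1)], of "(w i)\<^sup>2"]
      by (simp add: \<phi> cong: has_sum_cong)
    moreover from this have c: "c x i = (w i)\<^sup>2 * ?s" by (simp add: c_def infsumI)
    ultimately show "((\<lambda>l. \<phi> x (i, l)) has_sum c x i) (L i)" by simp
    have "A * (norm ?P)\<^sup>2 \<le> ?s" "?s \<le> B * (norm ?P)\<^sup>2"
      using s(2,3) mult_right_mono[OF A(2)[OF i], of "(norm ?P)\<^sup>2"]
        mult_right_mono[OF B(2)[OF i], of "(norm ?P)\<^sup>2"] by auto
    then have "(w i)\<^sup>2 * (A * (norm ?P)\<^sup>2) \<le> (w i)\<^sup>2 * ?s" "(w i)\<^sup>2 * ?s \<le> (w i)\<^sup>2 * (B * (norm ?P)\<^sup>2)"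
      by (auto intro!: mult_left_mono)
    then show "A * p x i \<le> c x i" "c x i \<le> B * p x i"
      by (simp_all add: c p_def mult_ac)
  qed
  have p_nonneg: "0 \<le> p x i" for x i by (simp add: p_def)
  \<comment> \<open>Forwards, \<open>A * p x i \<le> c x i\<close> gives the comparison; backwards,
    \<open>c x i \<le> B * p x i\<close> does, and nonnegativity lifts summability from the inner
    sums to \<open>Sigma I L\<close>.\<close>
  have summ: "\<phi> x summable_on Sigma I L \<longleftrightarrow> p x summable_on I" for x
  proof
    assume "\<phi> x summable_on Sigma I L"
    from has_sum_SigmaD[OF has_sum_infsum[OF this] inner(1)]
    have "c x summable_on I" by (auto simp: summable_on_def)
    then have "(\<lambda>i. (1 / A) * c x i) summable_on I" by (rule summable_on_cmult_right)
    then show "p x summable_on I"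
      by (rule summable_on_comparison_test)
        (use inner(2) p_nonneg A(1) in \<open>auto simp: field_simps\<close>)
  next
    assume "p x summable_on I"
    then have "(\<lambda>i. B * p x i) summable_on I" by (rule summable_on_cmult_right)
    then have "c x summable_on I"
    proof (rule summable_on_comparison_test)
      fix i assume i: "i \<in> I"
      have "0 \<le> A * p x i" using A(1) p_nonneg by simp
      then show "0 \<le> c x i" using inner(2)[OF i, of x] by linarith
    qed (use inner(3) in auto)
    with inner(1) show "\<phi> x summable_on Sigma I L"
      by (rule summable_on_SigmaI) (auto simp: \<phi>_def)
  qed
  have bounds: "A * infsum (p x) I \<le> infsum (\<phi> x) (Sigma I L)"
    "infsum (\<phi> x) (Sigma I L) \<le> B * infsum (p x) I"
    if p: "p x summable_on I" for x
  proof -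
    have c: "(c x has_sum infsum (\<phi> x) (Sigma I L)) I"
      using has_sum_SigmaD[OF has_sum_infsum inner(1)] summ p by blast
    show "A * infsum (p x) I \<le> infsum (\<phi> x) (Sigma I L)"
      using has_sum_cmult_right[OF has_sum_infsum[OF p], of A] c inner(2) by (rule has_sum_mono)
    show "infsum (\<phi> x) (Sigma I L) \<le> B * infsum (p x) I"
      using c has_sum_cmult_right[OF has_sum_infsum[OF p], of B] inner(3) by (rule has_sum_mono)
  qed
  have frame: "is_frame ip UNIV (Sigma I L) (\<lambda>(i, l). w i *\<^sub>R f i l) \<longleftrightarrow>
      (\<exists>a b. 0 < a \<and> a \<le> b \<and> (\<forall>x. \<phi> x summable_on Sigma I L \<and>
        a * (norm x)\<^sup>2 \<le> infsum (\<phi> x) (Sigma I L) \<and> infsum (\<phi> x) (Sigma I L) \<le> b * (norm x)\<^sup>2))"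
    using I f by (auto simp: is_frame_def frame_with_bounds_def \<phi>_def case_prod_unfold)
  have fusion: "fusion_frame scl ip I W w \<longleftrightarrow>
      (\<exists>a b. 0 < a \<and> a \<le> b \<and> (\<forall>x. p x summable_on I \<and>
        a * (norm x)\<^sup>2 \<le> infsum (p x) I \<and> infsum (p x) I \<le> b * (norm x)\<^sup>2))"
    using I W w by (simp add: fusion_frame_def p_def[abs_def])
  show ?thesis
    unfolding frame fusion
  proof (intro iffI; elim exE conjE)
    fix a b :: real assume ab: "0 < a" "a \<le> b" and x: "\<forall>x. \<phi> x summable_on Sigma I L \<and>
        a * (norm x)\<^sup>2 \<le> infsum (\<phi> x) (Sigma I L) \<and> infsum (\<phi> x) (Sigma I L) \<le> b * (norm x)\<^sup>2"
    \<comment> \<open>The maximum secures that the lower bound does not exceed the upper one without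
      comparing \<open>A\<close> with \<open>B\<close>; it recurs in the converse direction.\<close>
    have "p x summable_on I \<and> a / B * (norm x)\<^sup>2 \<le> infsum (p x) I \<and>
        infsum (p x) I \<le> max (a / B) (b / A) * (norm x)\<^sup>2" for x
    proof -
      have p: "p x summable_on I" using x summ by blast
      have 1: "a / B * (norm x)\<^sup>2 \<le> infsum (p x) I"
        using order_trans[OF _ bounds(2)[OF p]] x B(1) by (simp add: field_simps)
      have "infsum (p x) I \<le> b / A * (norm x)\<^sup>2"
        using order_trans[OF bounds(1)[OF p]] x A(1) by (simp add: field_simps)
      also have "\<dots> \<le> max (a / B) (b / A) * (norm x)\<^sup>2" by (intro mult_right_mono) auto
      finally show ?thesis using p 1 by blast
    qed
    moreover have "0 < a / B" using ab B(1) by simp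
    ultimately show "\<exists>a b. 0 < a \<and> a \<le> b \<and> (\<forall>x. p x summable_on I \<and>
        a * (norm x)\<^sup>2 \<le> infsum (p x) I \<and> infsum (p x) I \<le> b * (norm x)\<^sup>2)"
      by (intro exI[of _ "a / B"] exI[of _ "max (a / B) (b / A)"]) auto
  next
    fix a b :: real assume ab: "0 < a" "a \<le> b" and x: "\<forall>x. p x summable_on I \<and>
        a * (norm x)\<^sup>2 \<le> infsum (p x) I \<and> infsum (p x) I \<le> b * (norm x)\<^sup>2"
    have "\<phi> x summable_on Sigma I L \<and> A * a * (norm x)\<^sup>2 \<le> infsum (\<phi> x) (Sigma I L) \<and>
        infsum (\<phi> x) (Sigma I L) \<le> max (A * a) (B * b) * (norm x)\<^sup>2" for x
    proof -
      have p: "p x summable_on I" using x by blast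
      have "A * (a * (norm x)\<^sup>2) \<le> A * infsum (p x) I" using x A(1) by simp
      then have 1: "A * a * (norm x)\<^sup>2 \<le> infsum (\<phi> x) (Sigma I L)"
        using bounds(1)[OF p] by (simp add: mult.assoc)
      have "B * infsum (p x) I \<le> B * (b * (norm x)\<^sup>2)" using x B(1) by simp
      then have "infsum (\<phi> x) (Sigma I L) \<le> B * b * (norm x)\<^sup>2"
        using bounds(2)[OF p] by (simp add: mult.assoc)
      also have "\<dots> \<le> max (A * a) (B * b) * (norm x)\<^sup>2" by (intro mult_right_mono) auto
      finally show ?thesis using p 1 summ by blast
    qed
    moreover have "0 < A * a" using ab A(1) by simp
    ultimately show "\<exists>a b. 0 < a \<and> a \<le> b \<and> (\<forall>x. \<phi> x summable_on Sigma I L \<and>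
        a * (norm x)\<^sup>2 \<le> infsum (\<phi> x) (Sigma I L) \<and> infsum (\<phi> x) (Sigma I L) \<le> b * (norm x)\<^sup>2)"
      by (intro exI[of _ "A * a"] exI[of _ "max (A * a) (B * b)"]) auto
  qed
qed

end

section \<open>Dual frames and \<open>Q\<close>-dual fusion frames\<close>

theorem theorem3p12:
  fixes scl :: "'k::real_or_complex \<Rightarrow> 'h::banach \<Rightarrow> 'h"
    and ip :: "'h \<Rightarrow> 'h \<Rightarrow> 'k"
    and I :: "'i set"
    and L :: "'i \<Rightarrow> 'l set"
    and W V :: "'i \<Rightarrow> 'h set"
    and w v :: "'i \<Rightarrow> real"
    and f g :: "'i \<Rightarrow> 'l \<Rightarrow> 'h"
    and \<alpha> \<beta> \<alpha>' \<beta>' :: "'i \<Rightarrow> real"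
    and Q :: "('i \<Rightarrow> 'h) \<Rightarrow> ('i \<Rightarrow> 'h)"
  assumes "hilbert_space scl ip"
    and "separable_space (euclidean :: 'h topology)"
    and "countable I"
    and "\<And>i. i \<in> I \<Longrightarrow> countable (L i)"
    and "\<And>i. i \<in> I \<Longrightarrow> 0 < w i"
    and "\<And>i. i \<in> I \<Longrightarrow> 0 < v i"
    and "bounded (w ` I)"
    and "bounded (v ` I)"
    and "\<And>i. i \<in> I \<Longrightarrow> closed_subspace scl (W i)"
    and "\<And>i. i \<in> I \<Longrightarrow> closed_subspace scl (V i)"
    and "\<And>i. i \<in> I \<Longrightarrow> frame_with_bounds ip (W i) (L i) (f i) (\<alpha> i) (\<beta> i)"
    and "\<And>i. i \<in> I \<Longrightarrow> frame_with_bounds ip (V i) (L i) (g i) (\<alpha>' i) (\<beta>' i)"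
    and "0 < (INF i\<in>I. ereal (\<alpha> i))"
    and "(INF i\<in>I. ereal (\<alpha> i)) \<le> (SUP i\<in>I. ereal (\<beta> i))"
    and "(SUP i\<in>I. ereal (\<beta> i)) < \<infinity>"
    and "0 < (INF i\<in>I. ereal (\<alpha>' i))"
    and "(INF i\<in>I. ereal (\<alpha>' i)) \<le> (SUP i\<in>I. ereal (\<beta>' i))"
    and "(SUP i\<in>I. ereal (\<beta>' i)) < \<infinity>"
    and Q_def: "Q = (\<lambda>h i. if i \<in> I then \<Sum>\<^sub>\<infinity>l\<in>L i. scl (ip (h i) (f i l)) (g i l) else 0)"
  shows "dual_frames scl ip UNIV (Sigma I L)
           (\<lambda>(i, l). w i *\<^sub>R f i l) (\<lambda>(i, l). v i *\<^sub>R g i l)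
         \<longleftrightarrow> Q_dual_fusion_frame scl ip I Q V v W w"
proof -
  interpret hilbert_space scl ip by fact
  \<comment> \<open>Over an empty \<open>I\<close> the infimum would be \<infinity> and the supremum
    its negative, against the assumed inequality.\<close>
  have "I \<noteq> {}" using assms(14) by (auto simp: bot_ereal_def top_ereal_def)
  have lower: "\<exists>A>0. \<forall>i\<in>I. A \<le> a i" if a: "0 < (INF i\<in>I. ereal (a i))" for a :: "'i \<Rightarrow> real"
  proof -
    obtain r where r: "0 < ereal r" "ereal r < (INF i\<in>I. ereal (a i))"
      using ereal_dense2[OF a] by blast
    have "r \<le> a i" if "i \<in> I" for i
      using less_INF_D[OF r(2) that] by simp
    then show ?thesis using r(1) by auto
  qed
  have upper: "\<exists>B. \<forall>i\<in>I. b i \<le> B" if b: "(SUP i\<in>I. ereal (b i)) < \<infinity>" for b :: "'i \<Rightarrow> real"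
  proof -
    obtain r where r: "(SUP i\<in>I. ereal (b i)) < ereal r" using ereal_dense2[OF b] by blast
    have "b i \<le> r" if "i \<in> I" for i
      using SUP_lessD[OF r that] by simp
    then show ?thesis by auto
  qed
  obtain A where A: "0 < A" "\<And>i. i \<in> I \<Longrightarrow> A \<le> \<alpha> i" using lower[OF assms(13)] by blast
  obtain A' where A': "0 < A'" "\<And>i. i \<in> I \<Longrightarrow> A' \<le> \<alpha>' i" using lower[OF assms(16)] by blast
  obtain B where B: "\<And>i. i \<in> I \<Longrightarrow> \<beta> i \<le> B" using upper[OF assms(15)] by blast
  obtain B' where B': "\<And>i. i \<in> I \<Longrightarrow> \<beta>' i \<le> B'" using upper[OF assms(18)] by blast
  \<comment> \<open>A single index suffices to make \<open>B\<close> and \<open>B'\<close> positive,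
    as each dominates a positive local bound there.\<close>
  obtain i0 where i0: "i0 \<in> I" using \<open>I \<noteq> {}\<close> by blast
  have pos: "0 < B" "0 < B'"
    using assms(11)[OF i0] assms(12)[OF i0] B[OF i0] B'[OF i0] by (auto simp: frame_with_bounds_def)
  have frame_W: "is_frame ip UNIV (Sigma I L) (\<lambda>(i, l). w i *\<^sub>R f i l) \<longleftrightarrow> fusion_frame scl ip I W w"
    by (rule frame_iff_fusion_frame[OF assms(3,9,5,11) A pos(1) B])
  have frame_V: "is_frame ip UNIV (Sigma I L) (\<lambda>(i, l). v i *\<^sub>R g i l) \<longleftrightarrow> fusion_frame scl ip I V v"
    by (rule frame_iff_fusion_frame[OF assms(3,10,6,12) A' pos(2) B'])
  have bounded: "dsum_bounded_linear scl I W V Q"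
    unfolding Q_def
    using dsum_bounded_linear_frame_operator[OF assms(11,12,10) B B'] pos by simp
  have recon: "((\<lambda>j. scl (ip x ((\<lambda>(i, l). w i *\<^sub>R f i l) j)) ((\<lambda>(i, l). v i *\<^sub>R g i l) j)) has_sum x)
      (Sigma I L) \<longleftrightarrow> synthesis I v (Q (analysis ip I W w x)) = x"
    if fw: "fusion_frame scl ip I W w" and fv: "fusion_frame scl ip I V v" for x
  proof -
    let ?t = "\<lambda>i l. scl (ip x (w i *\<^sub>R f i l)) (v i *\<^sub>R g i l)"
    \<comment> \<open>Both weighted families are frames for the whole space, so the double series is
      unconditionally summable. This is what permits replacing it by an iterated sum.\<close>
    obtain a b a' b' where
      "frame_with_bounds ip UNIV (Sigma I L) (\<lambda>(i, l). w i *\<^sub>R f i l) a b"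
      "frame_with_bounds ip UNIV (Sigma I L) (\<lambda>(i, l). v i *\<^sub>R g i l) a' b'"
      using fw fv frame_W frame_V by (auto simp: is_frame_def)
    from frame_operator_bound(1)[OF this subspace_UNIV UNIV_I[of x]]
    have t: "(\<lambda>(i, l). ?t i l) summable_on Sigma I L" by (simp add: case_prod_unfold)
    have "synthesis I v (Q (analysis ip I W w x)) = (\<Sum>\<^sub>\<infinity>i\<in>I. \<Sum>\<^sub>\<infinity>l\<in>L i. ?t i l)"
      unfolding synthesis_def
    proof (rule infsum_cong)
      fix i assume i: "i \<in> I"
      \<comment> \<open>Insert the explicit analysis operator and move \<open>v i\<close> inside the
        sum. The projection then disappears because \<open>f i l\<close> lies in
        \<open>W i\<close>.\<close>
      have "v i *\<^sub>R Q (analysis ip I W w x) i =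
          (\<Sum>\<^sub>\<infinity>l\<in>L i. v i *\<^sub>R scl (ip (w i *\<^sub>R orth_proj ip (W i) x) (f i l)) (g i l))"
        by (simp only: Q_def analysis_eq[OF fw] i if_True infsum_scaleR_right)
      also have "\<dots> = (\<Sum>\<^sub>\<infinity>l\<in>L i. ?t i l)"
      proof (rule infsum_cong)
        fix l assume "l \<in> L i"
        then have "f i l \<in> W i" using assms(11)[OF i] by (simp add: frame_with_bounds_def)
        then show "v i *\<^sub>R scl (ip (w i *\<^sub>R orth_proj ip (W i) x) (f i l)) (g i l) = ?t i l"
          using assms(9)[OF i] by (simp add: ip_orth_proj scl_scaleR)
      qed
      finally show "v i *\<^sub>R Q (analysis ip I W w x) i = (\<Sum>\<^sub>\<infinity>l\<in>L i. ?t i l)" .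
    qed
    also have "\<dots> = infsum (\<lambda>(i, l). ?t i l) (Sigma I L)" using t by (rule infsum_Sigma'_banach)
    finally show ?thesis
      using t by (simp add: has_sum_iff case_prod_unfold)
  qed
  \<comment> \<open>Either side of the equivalence makes both families fusion frames, which is the
    premise of \<open>recon\<close>; \<open>bounded\<close> supplies the remaining clause of
    \<open>Q_dual_fusion_frame\<close>.\<close>
  show ?thesis
    using recon bounded by (auto simp: dual_frames_def Q_dual_fusion_frame_def frame_W frame_V)
qed

end
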